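(* For every $n\ge1$, $$\overline{A}_n(x,y)=\sum_{i=0}^{\lfloor n/2\rfloor}(-1)^i\,\bar d(n,i)\,(x+y)^i(1+x+y+xy)^{\lfloor n/2\rfloor-i},$$ and $rs_{n-1}(1+x)=\sum_{i=0}^{\lfloor n/2\rfloor}\bar d(n,i)x^i$.
   Context: For $\sigma\in\mathfrak{S}_n$, a position $i\in[n-1]$ is a descent if $\sigma(i)>\sigma(i+1)$ and an ascent if $\sigma(i)<\sigma(i+1)$; $\mathrm{des}_1\sigma$ is the number of descents at odd positions, $\mathrm{asc}_0\sigma$ the number of ascents at even positions. $\widehat{A}_n(x,y)=\sum_{\sigma\in\mathfrak{S}_n}x^{\mathrm{des}_1\sigma}y^{\mathrm{asc}_0\sigma}$, and $\overline{A}_{2m}(x,y)=(1+y)\widehat{A}_{2m}(x,y)$, $\overline{A}_{2m-1}(x,y)=\widehat{A}_{2m-1}(x,y)$. The $\pi(i)$-factorization of $\pi=\pi(1)\cdots\pi(n)$ is $(w_1,w_2,\pi(i),w_4,w_5)$ with $w_1w_2\pi(i)w_4w_5=\pi$, $w_2$ the longest right factor of $\pi(1)\cdots\pi(i-1)$ with all letters $>\pi(i)$, and $w_4$ the longest left factor of $\pi(i+1)\cdots\pi(n)$ with all letters $>\pi(i)$. An André permutation is $\pi\in\mathfrak{S}_n$ with no double descents, $\pi(n-1)<\pi(n)$, and such that for every valley $i$ ($2\le i\le n-1$, $\pi(i-1)>\pi(i)<\pi(i+1)$) the maximum letter of $w_2$ is smaller than the maximum letter of $w_4$ in its $\pi(i)$-factorization.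 $d(n,j)$ is the number of André permutations of length $n$ with $j$ descents, and $\bar d(n,i)=\sum_{j=i}^{\lfloor n/2\rfloor}\binom{j}{i}d(n,j)$. A permutation $w$ of $[m]$ is a Simsun permutation if for every $k=1,\dots,m$ the subsequence of $w$ formed by its $k$ smallest letters has no three consecutive entries in decreasing order; $rs_m(x)=\sum_w x^{\mathrm{des}\,w}$ over Simsun permutations of $[m]$ ($rs_0=1$). *)

theory Defs
  imports Complex_Main "HOL-Combinatorics.Multiset_Permutations" "HOL-Library.Sublist"
begin

text \<open>
  A permutation of \<open>[n]\<close> is represented by its one-line word, an element of
  \<^term>\<open>permutations_of_set {1..n}\<close>. Positions are counted from 1.
\<close>

definition letter :: "nat list \<Rightarrow> nat \<Rightarrow> nat" where
  "letter w i = w ! (i - 1)"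

definition descents :: "nat list \<Rightarrow> nat set" where
  "descents w = {i. 1 \<le> i \<and> i < length w \<and> letter w i > letter w (i + 1)}"

definition ascents :: "nat list \<Rightarrow> nat set" where
  "ascents w = {i. 1 \<le> i \<and> i < length w \<and> letter w i < letter w (i + 1)}"

definition des :: "nat list \<Rightarrow> nat" where
  "des w = card (descents w)"

definition des1 :: "nat list \<Rightarrow> nat" where
  "des1 w = card {i \<in> descents w. odd i}"

definition asc0 :: "nat list \<Rightarrow> nat" where
  "asc0 w = card {i \<in> ascents w. even i}"

text \<open>
  Polynomials are given by their values at arbitrary elements of an arbitrary commutative ring.
  Taking the two indeterminates over the integers as arguments yields the formal polynomials,
  so identities for all commutative rings are exactly the formal polynomial identities.
\<close>

definition A_hat :: "nat \<Rightarrow> 'a::comm_ring_1 \<Rightarrow> 'a \<Rightarrow> 'a" where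
  "A_hat n x y = (\<Sum>w\<in>permutations_of_set {1..n}. x ^ des1 w * y ^ asc0 w)"

definition A_bar :: "nat \<Rightarrow> 'a::comm_ring_1 \<Rightarrow> 'a \<Rightarrow> 'a" where
  "A_bar n x y = (if even n then (1 + y) * A_hat n x y else A_hat n x y)"

definition double_descent :: "nat list \<Rightarrow> nat \<Rightarrow> bool" where
  "double_descent w i \<longleftrightarrow> 2 \<le> i \<and> i < length w \<and>
     letter w (i - 1) > letter w i \<and> letter w i > letter w (i + 1)"

definition valley :: "nat list \<Rightarrow> nat \<Rightarrow> bool" where
  "valley w i \<longleftrightarrow> 2 \<le> i \<and> i < length w \<and>
     letter w (i - 1) > letter w i \<and> letter w i < letter w (i + 1)"

definition letter_factorization ::
    "nat list \<Rightarrow> nat \<Rightarrow> nat list \<times> nat list \<times> nat \<times> nat list \<times> nat list \<Rightarrow> bool" where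
  "letter_factorization w i = (\<lambda>(w1, w2, a, w4, w5).
     a = letter w i \<and>
     w1 @ w2 = take (i - 1) w \<and> w4 @ w5 = drop i w \<and>
     (\<forall>b\<in>set w2. b > a) \<and>
     (\<forall>v. suffix v (take (i - 1) w) \<and> (\<forall>b\<in>set v. b > a) \<longrightarrow> length v \<le> length w2) \<and>
     (\<forall>b\<in>set w4. b > a) \<and>
     (\<forall>v. prefix v (drop i w) \<and> (\<forall>b\<in>set v. b > a) \<longrightarrow> length v \<le> length w4))"

lemma letter_factorization_append:
  assumes "letter_factorization w i (w1, w2, a, w4, w5)" "1 \<le> i" "i \<le> length w"
  shows "w1 @ w2 @ [a] @ w4 @ w5 = w"
proof -
  have "w = take (i - 1) w @ w ! (i - 1) # drop (Suc (i - 1)) w"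
    using assms(2,3) by (intro id_take_nth_drop) simp
  moreover have "w1 @ w2 = take (i - 1) w" "w4 @ w5 = drop i w" "a = w ! (i - 1)"
    using assms(1) by (auto simp: letter_factorization_def letter_def)
  ultimately show ?thesis
    using assms(2) by (simp flip: append_assoc)
qed

lemma letter_factorization_exists:
  "\<exists>w1 w2 w4 w5. letter_factorization w i (w1, w2, letter w i, w4, w5)"
proof -
  define P where "P = (\<lambda>b. b > letter w i)"
  have pre: "length v \<le> length (takeWhile P u)" if "prefix v u" "\<forall>b\<in>set v. P b" for v u
    using that by (auto simp: prefix_def takeWhile_append)
  define u where "u = rev (take (i - 1) w)"
  have "rev (dropWhile P u) @ rev (takeWhile P u) = take (i - 1) w"
    by (simp add: u_def flip: rev_append)
  moreover have "length v \<le> length (rev (takeWhile P u))"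
    if "suffix v (take (i - 1) w)" "\<forall>b\<in>set v. P b" for v
    using pre[of "rev v" u] that by (simp add: suffix_to_prefix u_def)
  ultimately have "letter_factorization w i
      (rev (dropWhile P u), rev (takeWhile P u), letter w i,
       takeWhile P (drop i w), dropWhile P (drop i w))"
    using pre[of _ "drop i w"] set_takeWhileD[of _ P]
    unfolding letter_factorization_def P_def by auto
  then show ?thesis
    by blast
qed

text \<open>For \<open>n \<le> 1\<close> there is no last pair of letters, and the condition on it is void.\<close>

definition andre_permutations :: "nat \<Rightarrow> nat list set" where
  "andre_permutations n = {w \<in> permutations_of_set {1..n}.
     (\<forall>i. \<not> double_descent w i) \<and>
     (n \<ge> 2 \<longrightarrow> letter w (n - 1) < letter w n) \<and>
     (\<forall>i. valley w i \<longrightarrow>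
        (\<forall>w1 w2 a w4 w5. letter_factorization w i (w1, w2, a, w4, w5) \<longrightarrow>
           Max (set w2) < Max (set w4)))}"

definition d :: "nat \<Rightarrow> nat \<Rightarrow> nat" where
  "d n j = card {w \<in> andre_permutations n. des w = j}"

definition d_bar :: "nat \<Rightarrow> nat \<Rightarrow> nat" where
  "d_bar n i = (\<Sum>j = i..n div 2. (j choose i) * d n j)"

text \<open>In a permutation of \<open>[m]\<close> the \<open>k\<close> smallest letters are those that are at most \<open>k\<close>.\<close>

definition simsun_permutations :: "nat \<Rightarrow> nat list set" where
  "simsun_permutations m = {w \<in> permutations_of_set {1..m}.
     \<forall>k\<in>{1..m}. \<forall>i. \<not> double_descent (filter (\<lambda>a. a \<le> k) w) i}"

definition rs :: "nat \<Rightarrow> 'a::comm_ring_1 \<Rightarrow> 'a" where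
  "rs m x = (\<Sum>w\<in>simsun_permutations m. x ^ des w)"

end

theory Submission
  imports Defs
begin

text \<open>
  Choose two letters \<open>m\<close> and \<open>z\<close>. A permutation in which \<open>m\<close> precedes \<open>z\<close> factors uniquely as
  \<open>u m v\<close> with \<open>z\<close> in \<open>v\<close>, and one in which \<open>z\<close> precedes \<open>m\<close> factors as \<open>u z v\<close> with \<open>m\<close> in \<open>v\<close>.
  If a weight is multiplicative for both factorizations, up to coefficients that add up to \<open>a\<close>
  for empty \<open>u\<close> and to \<open>q\<close> otherwise, then its sum over all permutations obeys the quadratic
  recurrence of \<open>andre_poly a b q\<close>, where \<open>b\<close> plays the role of \<open>a\<close> for the weight with odd and
  even positions exchanged.

  For descents and ascents counted by the parity of their positions take the minimal and the
  maximal letter: the coefficients are \<open>1\<close> and \<open>x\<close> for empty \<open>u\<close>, and \<open>x y\<close> and \<open>1\<close> in some order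
  otherwise, so \<open>a = 1 + x\<close>, \<open>b = 1 + y\<close> and \<open>q = 1 + x y\<close>. In an Andre permutation the minimal
  letter precedes the maximal one, so one of the two coefficients vanishes. The same happens
  with the two smallest letters of a strong Simsun permutation, one whose restrictions to the
  small letters also have no final descent. Finally \<open>u m v\<close> with minimal letter \<open>m\<close> is Simsun iff
  \<open>u\<close> is strong Simsun and \<open>v\<close> is Simsun, which yields the Andre polynomial of the next index.
  The expansion in \<open>d_bar\<close> is the binomial theorem for \<open>q = a b - (x + y)\<close>.
\<close>

section \<open>Permutations split around a letter\<close>

definition permutations_preceding :: "'a set \<Rightarrow> 'a \<Rightarrow> 'a set \<Rightarrow> 'a list set" where
  "permutations_preceding S a B =
     {u @ a # v |u v. u @ a # v \<in> permutations_of_set S \<and> B \<subseteq> set v}"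

lemma permutations_preceding_empty:
  assumes "a \<in> S"
  shows "permutations_preceding S a {} = permutations_of_set S"
proof (intro equalityI subsetI)
  fix w assume w: "w \<in> permutations_of_set S"
  then obtain u v where "w = u @ a # v"
    using assms by (metis permutations_of_setD(1) split_list)
  then show "w \<in> permutations_preceding S a {}"
    using w by (auto simp: permutations_preceding_def)
qed (auto simp: permutations_preceding_def)

lemma bij_betw_permutations_preceding:
  assumes "a \<in> S" "B \<subseteq> S - {a}"
  shows "bij_betw (\<lambda>(T, u, v). u @ a # v)
    (SIGMA T:Pow (S - insert a B). permutations_of_set T \<times> permutations_of_set (S - {a} - T))
    (permutations_preceding S a B)" (is "bij_betw ?join ?D _")
proof (rule bij_betw_imageI)
  show "inj_on ?join ?D"
  proof (rule inj_onI)
    fix s t assume "s \<in> ?D" "t \<in> ?D" "?join s = ?join t"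
    moreover obtain T u v where "s = (T, u, v)"
      by (cases s)
    moreover obtain T' u' v' where "t = (T', u', v')"
      by (cases t)
    ultimately show "s = t"
      by (auto simp: permutations_of_set_def append_Cons_eq_iff)
  qed
  show "?join ` ?D = permutations_preceding S a B"
  proof (intro equalityI subsetI)
    fix w assume "w \<in> ?join ` ?D"
    then show "w \<in> permutations_preceding S a B"
      using assms by (fastforce simp: permutations_preceding_def permutations_of_set_def)
  next
    fix w assume "w \<in> permutations_preceding S a B"
    then obtain u v where "w = u @ a # v" "u @ a # v \<in> permutations_of_set S" "B \<subseteq> set v"
      by (auto simp: permutations_preceding_def)
    then have "w = ?join (set u, u, v)" "(set u, u, v) \<in> ?D"
      by (auto simp: permutations_of_set_def)
    then show "w \<in> ?join ` ?D"
      by blast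
  qed
qed

lemma sum_permutations_preceding_split:
  assumes "finite S" "a \<in> S" "B \<subseteq> S - {a}"
  shows "(\<Sum>w\<in>permutations_preceding S a B. \<phi> w) =
    (\<Sum>T\<in>Pow (S - insert a B). \<Sum>u\<in>permutations_of_set T.
       \<Sum>v\<in>permutations_of_set (S - {a} - T). \<phi> (u @ a # v))"
  using assms(1)
  by (simp add: sum.reindex_bij_betw[OF bij_betw_permutations_preceding[OF assms(2,3)], symmetric]
      case_prod_unfold sum.Sigma sum.cartesian_product)

lemma sum_Pow_card:
  fixes g :: "nat \<Rightarrow> 'a::comm_semiring_1"
  assumes "finite X"
  shows "(\<Sum>T\<in>Pow X. g (card T)) = (\<Sum>k\<le>card X. of_nat (card X choose k) * g k)"
proof -
  have "(\<Sum>T\<in>Pow X. g (card T)) = (\<Sum>k\<le>card X. \<Sum>T\<in>{T \<in> Pow X. card T = k}. g (card T))"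
    using assms by (intro sum.group[symmetric]) (auto intro: card_mono)
  also have "\<dots> = (\<Sum>k\<le>card X. of_nat (card X choose k) * g k)"
    using assms by (intro sum.cong) (auto simp: n_subsets)
  finally show ?thesis .
qed

lemma sum_permutations_around_letter:
  fixes \<phi> f g :: "'b list \<Rightarrow> 'a::comm_semiring_1"
  assumes "a \<in> S" "B \<subseteq> S - {a}" "T \<subseteq> S - insert a B"
    and factor: "\<And>u v. u @ a # v \<in> permutations_of_set S \<Longrightarrow> B \<subseteq> set v \<Longrightarrow> length u = card T \<Longrightarrow>
          \<phi> (u @ a # v) = c * f u * g v"
  shows "(\<Sum>u\<in>permutations_of_set T. \<Sum>v\<in>permutations_of_set (S - {a} - T). \<phi> (u @ a # v)) =
    c * (\<Sum>u\<in>permutations_of_set T. f u) * (\<Sum>v\<in>permutations_of_set (S - {a} - T). g v)"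
proof -
  have "\<phi> (u @ a # v) = c * (f u * g v)"
    if "u \<in> permutations_of_set T" "v \<in> permutations_of_set (S - {a} - T)" for u v
  proof -
    have "u @ a # v \<in> permutations_of_set S" "B \<subseteq> set v"
      using that assms(1-3) by (auto simp: permutations_of_set_def)
    then show ?thesis
      using factor length_finite_permutations_of_set[OF that(1)] by (simp add: mult.assoc)
  qed
  then show ?thesis
    unfolding mult.assoc sum_product by (simp add: sum_distrib_left)
qed

lemma sum_permutations_preceding:
  fixes \<phi> f :: "'b list \<Rightarrow> 'a::comm_semiring_1" and g :: "nat \<Rightarrow> 'b list \<Rightarrow> 'a"
  assumes "finite S" "a \<in> S" "B \<subseteq> S - {a}" "card (S - insert a B) = n"
    and factor: "\<And>u v. u @ a # v \<in> permutations_of_set S \<Longrightarrow> B \<subseteq> set v \<Longrightarrow>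
          \<phi> (u @ a # v) = c (length u) * f u * g (length u) v"
    and left: "\<And>T. T \<subseteq> S - {a} \<Longrightarrow> (\<Sum>u\<in>permutations_of_set T. f u) = F (card T)"
    and right: "\<And>T k. T \<subseteq> S - {a} \<Longrightarrow> card T + k = card (S - {a}) \<Longrightarrow>
          (\<Sum>v\<in>permutations_of_set T. g k v) = G k"
  shows "(\<Sum>w\<in>permutations_preceding S a B. \<phi> w) =
    (\<Sum>k\<le>n. of_nat (n choose k) * (c k * F k * G k))"
proof -
  have "(\<Sum>u\<in>permutations_of_set T. \<Sum>v\<in>permutations_of_set (S - {a} - T). \<phi> (u @ a # v)) =
      c (card T) * F (card T) * G (card T)" if T: "T \<subseteq> S - insert a B" for T
  proof -
    have "T \<subseteq> S - {a}" "finite T"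
      using T assms(1) by (auto intro: finite_subset)
    then have "card (S - {a} - T) + card T = card (S - {a})"
      using assms(1) by (simp add: card_Diff_subset card_mono)
    then have "(\<Sum>v\<in>permutations_of_set (S - {a} - T). g (card T) v) = G (card T)"
      by (intro right) auto
    moreover have "(\<Sum>u\<in>permutations_of_set T. f u) = F (card T)"
      using \<open>T \<subseteq> S - {a}\<close> by (rule left)
    moreover have "(\<Sum>u\<in>permutations_of_set T. \<Sum>v\<in>permutations_of_set (S - {a} - T).
          \<phi> (u @ a # v)) = c (card T) * (\<Sum>u\<in>permutations_of_set T. f u) *
        (\<Sum>v\<in>permutations_of_set (S - {a} - T). g (card T) v)"
      using assms(2,3) T by (rule sum_permutations_around_letter) (simp add: factor)
    ultimately show ?thesis
      by simp
  qed
  then have "(\<Sum>w\<in>permutations_preceding S a B. \<phi> w) =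
      (\<Sum>T\<in>Pow (S - insert a B). c (card T) * F (card T) * G (card T))"
    unfolding sum_permutations_preceding_split[OF assms(1-3)] by (intro sum.cong) auto
  then show ?thesis
    using assms(1,4) sum_Pow_card[of "S - insert a B" "\<lambda>k. c k * F k * G k"] by simp
qed

lemma permutations_of_set_two_letters:
  assumes "a \<in> S" "b \<in> S" "a \<noteq> b"
  shows "permutations_of_set S = permutations_preceding S a {b} \<union> permutations_preceding S b {a}"
proof (intro equalityI subsetI)
  fix w assume w: "w \<in> permutations_of_set S"
  then obtain u v where uv: "w = u @ a # v"
    using assms(1) by (metis permutations_of_setD(1) split_list)
  show "w \<in> permutations_preceding S a {b} \<union> permutations_preceding S b {a}"
  proof (cases "b \<in> set v")
    case True
    then show ?thesis
      using w uv by (auto simp: permutations_preceding_def)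
  next
    case False
    then have "b \<in> set u"
      using assms(2,3) w uv by (auto dest!: permutations_of_setD(1))
    then obtain u1 u2 where "u = u1 @ b # u2"
      by (auto dest: split_list)
    then have "w = u1 @ b # (u2 @ a # v)"
      using uv by simp
    then show ?thesis
      using w unfolding permutations_preceding_def by fastforce
  qed
qed (auto simp: permutations_preceding_def)

lemma permutations_preceding_disjoint:
  "permutations_preceding S a {b} \<inter> permutations_preceding S b {a} = {}"
  by (auto simp: permutations_preceding_def permutations_of_set_def append_eq_append_conv2
      Cons_eq_append_conv append_eq_Cons_conv)

lemma sum_permutations_of_set_two_letters:
  assumes "a \<in> S" "b \<in> S" "a \<noteq> b"
  shows "(\<Sum>w\<in>permutations_of_set S. \<phi> w) =
    (\<Sum>w\<in>permutations_preceding S a {b}. \<phi> w) + (\<Sum>w\<in>permutations_preceding S b {a}. \<phi> w)"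
  unfolding permutations_of_set_two_letters[OF assms]
proof (rule sum.union_disjoint)
  show "finite (permutations_preceding S a {b})" "finite (permutations_preceding S b {a})"
    using finite_permutations_of_set[of S]
    unfolding permutations_of_set_two_letters[OF assms] by simp_all
qed (rule permutations_preceding_disjoint)

lemma set_permutation_around:
  assumes "u @ a # v \<in> permutations_of_set S"
  shows "set u \<union> set v = S - {a}" "set u \<inter> set v = {}"
proof -
  have "set (u @ a # v) = S" "distinct (u @ a # v)"
    using assms by (simp_all only: permutations_of_set_def mem_Collect_eq)
  then show "set u \<union> set v = S - {a}" "set u \<inter> set v = {}"
    by auto
qed

lemma Min_less_permutation_around:
  fixes S :: "'a::linorder set"
  assumes "finite S" "u @ Min S # v \<in> permutations_of_set S"
  shows "\<forall>a\<in>set u. Min S < a" "\<forall>a\<in>set v. Min S < a"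
proof -
  have "Min S < a" if "a \<in> S - {Min S}" for a
    using that assms(1) by (auto simp: order_less_le)
  then show "\<forall>a\<in>set u. Min S < a" "\<forall>a\<in>set v. Min S < a"
    using set_permutation_around(1)[OF assms(2)] by blast+
qed

lemma permutation_around_less_Max:
  fixes S :: "'a::linorder set"
  assumes "finite S" "u @ Max S # v \<in> permutations_of_set S"
  shows "\<forall>a\<in>set u. a < Max S" "\<forall>a\<in>set v. a < Max S"
proof -
  have "a < Max S" if "a \<in> S - {Max S}" for a
    using that assms(1) by (auto simp: order_less_le)
  then show "\<forall>a\<in>set u. a < Max S" "\<forall>a\<in>set v. a < Max S"
    using set_permutation_around(1)[OF assms(2)] by blast+
qed

lemma Min_Max_mem_of_card_ge_2:
  fixes S :: "'a::linorder set"
  assumes "finite S" "2 \<le> card S"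
  shows "Min S \<in> S" "Max S \<in> S - {Min S}"
proof -
  have "S \<noteq> {}"
    using assms(2) by auto
  then show "Min S \<in> S"
    using assms(1) by simp
  then have "card (S - {Min S}) \<noteq> 0"
    using assms by simp
  then obtain b where b: "b \<in> S - {Min S}"
    by (metis all_not_in_conv card.empty)
  then have "Min S < b"
    using assms(1) by (auto simp: order_less_le)
  also have "b \<le> Max S"
    using b assms(1) by simp
  finally show "Max S \<in> S - {Min S}"
    using assms(1) \<open>S \<noteq> {}\<close> by simp
qed

lemma Max_less_Max_permutation_around:
  fixes S :: "'a::linorder set"
  assumes "finite S" "u @ a # v \<in> permutations_of_set S" "Max S \<in> set v" "u \<noteq> []"
  shows "Max (set u) < Max (set v)"
proof -
  have "b < Max S" if "b \<in> set u" for b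
  proof -
    have "b \<in> S" "b \<noteq> Max S"
      using that set_permutation_around(1,2)[OF assms(2)] assms(3) by auto
    then show ?thesis
      using assms(1) by (auto simp: order_less_le)
  qed
  then have "Max (set u) < Max S"
    using assms(4) by simp
  also have "Max S \<le> Max (set v)"
    using assms(3) by (intro Max_ge) auto
  finally show ?thesis .
qed

section \<open>The Andre polynomials\<close>

fun andre_poly :: "'a::comm_semiring_1 \<Rightarrow> 'a \<Rightarrow> 'a \<Rightarrow> nat \<Rightarrow> 'a" where
  "andre_poly a b q 0 = 1"
| "andre_poly a b q (Suc 0) = 1"
| "andre_poly a b q (Suc (Suc n)) = (\<Sum>k\<le>n. of_nat (n choose k) *
     ((if k = 0 then a else q) * andre_poly a b q k *
      (if odd k then andre_poly a b q (Suc n - k) else andre_poly b a q (Suc n - k))))"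

text \<open>
  In \<open>u @ m # v\<close> the factor \<open>v\<close> starts at position \<open>length u + 2\<close>, so a left factor of even length
  exchanges odd and even positions of \<open>v\<close>; accordingly \<open>\<phi>\<close> is replaced by its companion \<open>\<psi>\<close>.
\<close>

definition factors_around ::
    "('b list \<Rightarrow> 'a::comm_semiring_1) \<Rightarrow> ('b list \<Rightarrow> 'a) \<Rightarrow> (nat \<Rightarrow> 'a) \<Rightarrow> 'b set \<Rightarrow> 'b \<Rightarrow> 'b \<Rightarrow> bool" where
  "factors_around \<phi> \<psi> c S m z \<longleftrightarrow> (\<forall>u v. u @ m # v \<in> permutations_of_set S \<longrightarrow> z \<in> set v \<longrightarrow>
     \<phi> (u @ m # v) = c (length u) * \<phi> u * (if odd (length u) then \<phi> v else \<psi> v))"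

definition andre_recursive ::
    "('b list \<Rightarrow> 'a::comm_semiring_1) \<Rightarrow> ('b list \<Rightarrow> 'a) \<Rightarrow> 'a \<Rightarrow> 'a \<Rightarrow> bool" where
  "andre_recursive \<phi> \<psi> a q \<longleftrightarrow> \<phi> [] = 1 \<and> (\<forall>x. \<phi> [x] = 1) \<and>
     (\<forall>S. finite S \<and> 2 \<le> card S \<longrightarrow> (\<exists>m\<in>S. \<exists>z\<in>S - {m}. \<exists>c c'.
        factors_around \<phi> \<psi> c S m z \<and> factors_around \<phi> \<psi> c' S z m \<and>
        (\<forall>k. c k + c' k = (if k = 0 then a else q))))"

lemma andre_recursiveI:
  fixes \<phi> \<psi> :: "'b list \<Rightarrow> 'a::comm_semiring_1"
  assumes "\<phi> [] = 1" "\<And>x. \<phi> [x] = 1"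
    and "\<And>S. finite S \<Longrightarrow> 2 \<le> card S \<Longrightarrow> m S \<in> S"
    and "\<And>S. finite S \<Longrightarrow> 2 \<le> card S \<Longrightarrow> z S \<in> S - {m S}"
    and "\<And>S. finite S \<Longrightarrow> 2 \<le> card S \<Longrightarrow> factors_around \<phi> \<psi> c S (m S) (z S)"
    and "\<And>S. finite S \<Longrightarrow> 2 \<le> card S \<Longrightarrow> factors_around \<phi> \<psi> c' S (z S) (m S)"
    and "\<And>k. c k + c' k = (if k = 0 then a else q)"
  shows "andre_recursive \<phi> \<psi> a q"
  unfolding andre_recursive_def
proof (intro conjI allI impI)
  fix S :: "'b set" assume "finite S \<and> 2 \<le> card S"
  then have "m S \<in> S" "z S \<in> S - {m S}"
    "factors_around \<phi> \<psi> c S (m S) (z S)" "factors_around \<phi> \<psi> c' S (z S) (m S)"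
    using assms(3-6) by blast+
  then show "\<exists>m\<in>S. \<exists>z\<in>S - {m}. \<exists>c c'.
      factors_around \<phi> \<psi> c S m z \<and> factors_around \<phi> \<psi> c' S z m \<and>
      (\<forall>k. c k + c' k = (if k = 0 then a else q))"
    using assms(7) by blast
qed (fact assms(1,2))+

lemma sum_factors_around:
  assumes factor: "factors_around \<phi> \<psi> c S m z"
    and S: "finite S" "card S = Suc (Suc n)" "m \<in> S" "z \<in> S" "m \<noteq> z"
    and \<phi>: "\<And>T. T \<subseteq> S - {m} \<Longrightarrow> (\<Sum>u\<in>permutations_of_set T. \<phi> u) = F (card T)"
    and \<psi>: "\<And>T. T \<subseteq> S - {m} \<Longrightarrow> (\<Sum>u\<in>permutations_of_set T. \<psi> u) = G (card T)"
  shows "(\<Sum>w\<in>permutations_preceding S m {z}. \<phi> w) =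
    (\<Sum>k\<le>n. of_nat (n choose k) * (c k * F k * (if odd k then F (Suc n - k) else G (Suc n - k))))"
proof (rule sum_permutations_preceding)
  show "card (S - insert m {z}) = n"
    using S by (simp add: card_Diff_insert)
  show "\<phi> (u @ m # v) = c (length u) * \<phi> u * (if odd (length u) then \<phi> v else \<psi> v)"
    if "u @ m # v \<in> permutations_of_set S" "{z} \<subseteq> set v" for u v
    using that factor by (simp add: factors_around_def)
  show "(\<Sum>v\<in>permutations_of_set T. if odd k then \<phi> v else \<psi> v) =
      (if odd k then F (Suc n - k) else G (Suc n - k))"
    if "T \<subseteq> S - {m}" "card T + k = card (S - {m})" for T k
  proof -
    have "card T = Suc n - k"
      using that(2) S by simp
    then show ?thesis
      using \<phi>[OF that(1)] \<psi>[OF that(1)] by simp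
  qed
qed (use S \<phi> in auto)

lemma sum_permutations_factors_around:
  assumes "factors_around \<phi> \<psi> c S m z" "factors_around \<phi> \<psi> c' S z m"
    and S: "finite S" "card S = Suc (Suc n)" "m \<in> S" "z \<in> S" "m \<noteq> z"
    and \<phi>: "\<And>T. T \<subset> S \<Longrightarrow> (\<Sum>u\<in>permutations_of_set T. \<phi> u) = F (card T)"
    and \<psi>: "\<And>T. T \<subset> S \<Longrightarrow> (\<Sum>u\<in>permutations_of_set T. \<psi> u) = G (card T)"
  shows "(\<Sum>w\<in>permutations_of_set S. \<phi> w) = (\<Sum>k\<le>n. of_nat (n choose k) *
    ((c k + c' k) * F k * (if odd k then F (Suc n - k) else G (Suc n - k))))"
proof -
  let ?R = "\<lambda>k. if odd k then F (Suc n - k) else G (Suc n - k)"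
  have "(\<Sum>w\<in>permutations_preceding S m {z}. \<phi> w) =
      (\<Sum>k\<le>n. of_nat (n choose k) * (c k * F k * ?R k))"
    using assms(1) S by (rule sum_factors_around) (use S(3) \<phi> \<psi> in auto)
  moreover have "(\<Sum>w\<in>permutations_preceding S z {m}. \<phi> w) =
      (\<Sum>k\<le>n. of_nat (n choose k) * (c' k * F k * ?R k))"
    using assms(2) S(1,2,4,3) S(5)[symmetric]
    by (rule sum_factors_around) (use S(4) \<phi> \<psi> in auto)
  ultimately show ?thesis
    unfolding sum_permutations_of_set_two_letters[OF S(3-5)]
    by (simp add: distrib_left distrib_right flip: sum.distrib)
qed

lemma sum_permutations_eq_andre_poly:
  assumes "andre_recursive \<phi> \<psi> a q" "andre_recursive \<psi> \<phi> b q" "finite S"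
  shows "(\<Sum>w\<in>permutations_of_set S. \<phi> w) = andre_poly a b q (card S)"
  using assms
proof (induction "card S" arbitrary: S \<phi> \<psi> a b rule: less_induct)
  case less
  note fin = less.prems(3)
  consider "card S = 0" | "card S = 1" | n where "card S = Suc (Suc n)"
    by (metis One_nat_def not0_implies_Suc)
  then show ?case
  proof cases
    case 1
    then show ?thesis
      using less.prems(1) fin by (simp add: andre_recursive_def)
  next
    case 2
    then obtain x where "S = {x}"
      by (rule card_1_singletonE)
    then show ?thesis
      using less.prems(1) by (simp add: andre_recursive_def)
  next
    case (3 n)
    have "\<exists>m\<in>S. \<exists>z\<in>S - {m}. \<exists>c c'.
        factors_around \<phi> \<psi> c S m z \<and> factors_around \<phi> \<psi> c' S z m \<and>
        (\<forall>k. c k + c' k = (if k = 0 then a else q))"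
      using less.prems(1) fin 3 by (simp add: andre_recursive_def)
    then obtain m z c c' where mz: "m \<in> S" "z \<in> S" "m \<noteq> z"
      and factor: "factors_around \<phi> \<psi> c S m z" "factors_around \<phi> \<psi> c' S z m"
      and c: "\<And>k. c k + c' k = (if k = 0 then a else q)"
      by (metis DiffE insertI1)
    have IH: "(\<Sum>u\<in>permutations_of_set T. \<phi> u) = andre_poly a b q (card T)"
      "(\<Sum>u\<in>permutations_of_set T. \<psi> u) = andre_poly b a q (card T)" if "T \<subset> S" for T
      using less.hyps less.prems that by (meson finite_subset psubset_card_mono psubset_imp_subset)+
    show ?thesis
      using sum_permutations_factors_around[OF factor fin 3 mz IH]
      unfolding c 3 andre_poly.simps .
  qed
qed

section \<open>Descents and ascents of concatenations\<close>

definition adjacent_positions :: "(nat \<Rightarrow> nat \<Rightarrow> bool) \<Rightarrow> nat list \<Rightarrow> nat set" where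
  "adjacent_positions R w = {i. 1 \<le> i \<and> i < length w \<and> R (letter w i) (letter w (i + 1))}"

lemma descents_eq_adjacent_positions: "descents = adjacent_positions (>)"
  and ascents_eq_adjacent_positions: "ascents = adjacent_positions (<)"
  by (auto simp: fun_eq_iff descents_def ascents_def adjacent_positions_def)

lemma adjacent_positions_short [simp]:
  "adjacent_positions R [] = {}" "adjacent_positions R [a] = {}"
  by (auto simp: adjacent_positions_def)

lemma finite_adjacent_positions: "finite (adjacent_positions R w)"
  by (rule finite_subset[of _ "{..length w}"]) (auto simp: adjacent_positions_def)

lemma adjacent_positions_bounds: "adjacent_positions R w \<subseteq> {1..<length w}"
  by (auto simp: adjacent_positions_def)

lemma descents_bounds: "descents w \<subseteq> {1..<length w}"
  using adjacent_positions_bounds by (simp add: descents_eq_adjacent_positions)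

lemma adjacent_positions_append:
  "adjacent_positions R (u @ v) = adjacent_positions R u \<union>
     (if u \<noteq> [] \<and> v \<noteq> [] \<and> R (last u) (hd v) then {length u} else {}) \<union>
     (+) (length u) ` adjacent_positions R v"
proof (intro set_eqI)
  fix i
  consider "i < length u" | "i = length u" | j where "i = length u + Suc j"
    by (metis add_Suc_right less_imp_Suc_add linorder_neqE_nat)
  then show "i \<in> adjacent_positions R (u @ v) \<longleftrightarrow> i \<in> adjacent_positions R u \<union>
     (if u \<noteq> [] \<and> v \<noteq> [] \<and> R (last u) (hd v) then {length u} else {}) \<union>
     (+) (length u) ` adjacent_positions R v"
  proof cases
    case 1
    then show ?thesis
      by (auto simp: adjacent_positions_def letter_def nth_append)
  next
    case 2
    then show ?thesis
      by (auto simp: adjacent_positions_def letter_def nth_append last_conv_nth hd_conv_nth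
          Suc_le_eq)
  next
    case (3 j)
    then show ?thesis
      by (auto simp: adjacent_positions_def letter_def nth_append)
  qed
qed

lemma card_adjacent_positions_append:
  "card {i \<in> adjacent_positions R (u @ v). K i} = card {i \<in> adjacent_positions R u. K i} +
     of_bool (u \<noteq> [] \<and> v \<noteq> [] \<and> R (last u) (hd v) \<and> K (length u)) +
     card {i \<in> adjacent_positions R v. K (length u + i)}"
proof -
  define A B C where "A = {i \<in> adjacent_positions R u. K i}"
    and "B = (if u \<noteq> [] \<and> v \<noteq> [] \<and> R (last u) (hd v) \<and> K (length u) then {length u} else {})"
    and "C = (+) (length u) ` {i \<in> adjacent_positions R v. K (length u + i)}"
  have "{i \<in> adjacent_positions R (u @ v). K i} = A \<union> B \<union> C"
    by (auto simp: adjacent_positions_append A_def B_def C_def)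
  moreover have "finite A" "finite B" "finite C"
    by (auto simp: A_def B_def C_def finite_adjacent_positions)
  moreover have "A \<inter> B = {}" "(A \<union> B) \<inter> C = {}"
    using adjacent_positions_bounds[of R u] adjacent_positions_bounds[of R v]
    by (auto simp: A_def B_def C_def)
  moreover have "card B = of_bool (u \<noteq> [] \<and> v \<noteq> [] \<and> R (last u) (hd v) \<and> K (length u))"
    by (auto simp: B_def)
  moreover have "card C = card {i \<in> adjacent_positions R v. K (length u + i)}"
    by (simp add: C_def card_image)
  ultimately show ?thesis
    by (simp add: card_Un_disjoint A_def)
qed

lemma not_hd_less_and_less_last:
  fixes m :: "'a::order"
  assumes "\<forall>a\<in>set u. m < a" "\<forall>a\<in>set v. m < a"
  shows "v = [] \<or> \<not> hd v < m" "u = [] \<or> m < last u"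
proof -
  show "v = [] \<or> \<not> hd v < m"
    using assms(2) by (metis hd_in_set order_less_asym)
  show "u = [] \<or> m < last u"
    using assms(1) by (metis last_in_set)
qed

lemma descents_append_Cons:
  assumes "\<forall>a\<in>set u. m < a" "\<forall>a\<in>set v. m < a"
  shows "descents (u @ m # v) = descents u \<union> (if u = [] then {} else {length u}) \<union>
    (+) (Suc (length u)) ` descents v"
proof -
  have "descents (m # v) = Suc ` descents v"
    using not_hd_less_and_less_last(1)[OF assms] adjacent_positions_append[of "(>)" "[m]" v]
    unfolding descents_eq_adjacent_positions by auto
  then show ?thesis
    using not_hd_less_and_less_last(2)[OF assms] adjacent_positions_append[of "(>)" u "m # v"]
    unfolding descents_eq_adjacent_positions by (auto simp: image_image)
qed

lemma des_short [simp]: "des [] = 0" "des [a] = 0"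
  by (simp_all add: des_def descents_eq_adjacent_positions)

lemma des_append_Cons:
  assumes "\<forall>a\<in>set u. m < a" "\<forall>a\<in>set v. m < a"
  shows "des (u @ m # v) = des u + (if u = [] then 0 else 1) + des v"
  using not_hd_less_and_less_last[OF assms]
    card_adjacent_positions_append[of "(>)" u "m # v" "\<lambda>_. True"]
    card_adjacent_positions_append[of "(>)" "[m]" v "\<lambda>_. True"]
  unfolding des_def descents_eq_adjacent_positions by auto

definition no_double_descent :: "nat list \<Rightarrow> bool" where
  "no_double_descent w \<longleftrightarrow> (\<forall>i\<in>descents w. Suc i \<notin> descents w)"

definition no_double_or_final_descent :: "nat list \<Rightarrow> bool" where
  "no_double_or_final_descent w \<longleftrightarrow> (\<forall>i\<in>descents w. Suc i \<notin> descents w \<and> Suc i \<noteq> length w)"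

lemma no_descents_short [simp]:
  "no_double_descent []" "no_double_or_final_descent []" "no_double_or_final_descent [a]"
  by (simp_all add: no_double_descent_def no_double_or_final_descent_def
      descents_eq_adjacent_positions)

lemma all_not_double_descent_iff: "(\<forall>i. \<not> double_descent w i) \<longleftrightarrow> no_double_descent w"
proof -
  have "double_descent w (Suc i) \<longleftrightarrow> i \<in> descents w \<and> Suc i \<in> descents w" for i
    by (auto simp: double_descent_def descents_def)
  moreover have "\<not> double_descent w 0"
    by (simp add: double_descent_def)
  ultimately show ?thesis
    unfolding no_double_descent_def by (metis not0_implies_Suc)
qed

lemma ball_descents_append_Cons:
  assumes "\<forall>a\<in>set u. m < a" "\<forall>a\<in>set v. m < a"
  shows "(\<forall>i\<in>descents (u @ m # v). R i) \<longleftrightarrow> (\<forall>i\<in>descents u. R i) \<and>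
    (u \<noteq> [] \<longrightarrow> R (length u)) \<and> (\<forall>i\<in>descents v. R (Suc (length u + i)))"
  unfolding descents_append_Cons[OF assms] by auto

lemma Suc_mem_descents_append_Cons:
  assumes "\<forall>a\<in>set u. m < a" "\<forall>a\<in>set v. m < a"
  shows "i \<in> descents u \<Longrightarrow>
      Suc i \<in> descents (u @ m # v) \<longleftrightarrow> Suc i \<in> descents u \<or> Suc i = length u"
    and "Suc (length u) \<notin> descents (u @ m # v)"
    and "Suc (Suc (length u + i)) \<in> descents (u @ m # v) \<longleftrightarrow> Suc i \<in> descents v"
  using descents_bounds[of u] descents_bounds[of v]
  unfolding descents_append_Cons[OF assms] by (auto simp: image_iff)

lemma no_double_descent_append_Cons:
  assumes "\<forall>a\<in>set u. m < a" "\<forall>a\<in>set v. m < a"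
  shows "no_double_descent (u @ m # v) \<longleftrightarrow> no_double_or_final_descent u \<and> no_double_descent v"
  unfolding no_double_descent_def no_double_or_final_descent_def ball_descents_append_Cons[OF assms]
  using Suc_mem_descents_append_Cons[OF assms] by auto

lemma no_double_or_final_descent_append_Cons:
  assumes "\<forall>a\<in>set u. m < a" "\<forall>a\<in>set v. m < a"
  shows "no_double_or_final_descent (u @ m # v) \<longleftrightarrow>
    no_double_or_final_descent u \<and> no_double_or_final_descent v \<and> (v = [] \<longrightarrow> u = [])"
proof -
  have "Suc i \<noteq> length (u @ m # v)" if "i \<in> descents u" for i
    using that descents_bounds[of u] by auto
  then show ?thesis
    unfolding no_double_or_final_descent_def ball_descents_append_Cons[OF assms]
    using Suc_mem_descents_append_Cons[OF assms] by auto
qed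

lemma des_less_half_length:
  assumes "no_double_or_final_descent w" "w \<noteq> []"
  shows "2 * des w < length w"
proof -
  have fin: "finite (descents w)"
    by (simp add: descents_eq_adjacent_positions finite_adjacent_positions)
  have "2 * des w = card (descents w) + card (Suc ` descents w)"
    by (simp add: des_def card_image)
  also have "\<dots> = card (descents w \<union> Suc ` descents w)"
    using assms(1) fin
    by (intro card_Un_disjoint[symmetric]) (auto simp: no_double_or_final_descent_def)
  also have "\<dots> \<le> card {1..<length w}"
    using assms(1) by (intro card_mono) (force simp: no_double_or_final_descent_def descents_def)+
  also have "\<dots> < length w"
    using assms(2) by simp
  finally show ?thesis .
qed

section \<open>Odd descents and even ascents\<close>

definition parity_weight :: "'a::comm_semiring_1 \<Rightarrow> 'a \<Rightarrow> 'a \<Rightarrow> 'a \<Rightarrow> nat list \<Rightarrow> 'a" where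
  "parity_weight p q r s w =
     p ^ card {i \<in> descents w. odd i} * q ^ card {i \<in> ascents w. odd i} *
     (r ^ card {i \<in> descents w. even i} * s ^ card {i \<in> ascents w. even i})"

lemma A_hat_eq_sum_parity_weight:
  "A_hat n x y = (\<Sum>w\<in>permutations_of_set {1..n}. parity_weight x 1 1 y w)"
  by (simp add: A_hat_def parity_weight_def des1_def asc0_def)

lemma parity_weight_short [simp]: "parity_weight p q r s [] = 1" "parity_weight p q r s [a] = 1"
  by (simp_all add: parity_weight_def descents_eq_adjacent_positions ascents_eq_adjacent_positions)

lemma parity_weight_append:
  "parity_weight p q r s (u @ v) = parity_weight p q r s u *
     (if u = [] \<or> v = [] then 1
      else if last u > hd v then if odd (length u) then p else r
      else if last u < hd v then if odd (length u) then q else s else 1) *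
     (if odd (length u) then parity_weight r s p q v else parity_weight p q r s v)"
  unfolding parity_weight_def descents_eq_adjacent_positions ascents_eq_adjacent_positions
    card_adjacent_positions_append
  by (cases "even (length u)") (simp_all add: power_add mult_ac)

lemma parity_weight_append_Cons_less:
  assumes "\<forall>a\<in>set u. m < a" "\<forall>a\<in>set v. m < a" "v \<noteq> []"
  shows "parity_weight p q r s (u @ m # v) =
    (if u = [] then q else if odd (length u) then p * s else q * r) * parity_weight p q r s u *
    (if odd (length u) then parity_weight p q r s v else parity_weight r s p q v)"
proof -
  have "\<not> hd v < m" "m < hd v"
    using assms(2,3) by (simp_all add: order_less_imp_not_less)
  then have "parity_weight p q r s (m # v) = q * parity_weight r s p q v" for p q r s :: 'a
    using assms(3) parity_weight_append[of p q r s "[m]" v] by simp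
  moreover have "m < last u" if "u \<noteq> []"
    using assms(1) that by simp
  ultimately show ?thesis
    by (cases "u = []") (simp_all add: parity_weight_append[of _ _ _ _ u "m # v"] mult_ac)
qed

lemma parity_weight_append_Cons_greater:
  assumes "\<forall>a\<in>set u. a < z" "\<forall>a\<in>set v. a < z" "v \<noteq> []"
  shows "parity_weight p q r s (u @ z # v) =
    (if u = [] then p else if odd (length u) then q * r else p * s) * parity_weight p q r s u *
    (if odd (length u) then parity_weight p q r s v else parity_weight r s p q v)"
proof -
  have "parity_weight p q r s (z # v) = p * parity_weight r s p q v" for p q r s :: 'a
    using assms(2,3) parity_weight_append[of p q r s "[z]" v] by simp
  moreover have "last u < z" "\<not> z < last u" if "u \<noteq> []"
    using assms(1) that by (simp_all add: order_less_imp_not_less)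
  ultimately show ?thesis
    by (cases "u = []") (simp_all add: parity_weight_append[of _ _ _ _ u "z # v"] mult_ac)
qed

lemma andre_recursive_parity_weight:
  "andre_recursive (parity_weight p q r s) (parity_weight r s p q) (p + q) (p * s + q * r)"
proof (rule andre_recursiveI[where m = Min and z = Max
      and c = "\<lambda>k. if k = 0 then q else if odd k then p * s else q * r"
      and c' = "\<lambda>k. if k = 0 then p else if odd k then q * r else p * s"])
  fix S :: "nat set" assume S: "finite S" "2 \<le> card S"
  show "Min S \<in> S" "Max S \<in> S - {Min S}"
    using S by (rule Min_Max_mem_of_card_ge_2)+
  show "factors_around (parity_weight p q r s) (parity_weight r s p q)
      (\<lambda>k. if k = 0 then q else if odd k then p * s else q * r) S (Min S) (Max S)"
    unfolding factors_around_def
  proof (intro allI impI)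
    fix u v assume w: "u @ Min S # v \<in> permutations_of_set S" "Max S \<in> set v"
    then have "v \<noteq> []"
      by auto
    show "parity_weight p q r s (u @ Min S # v) =
        (if length u = 0 then q else if odd (length u) then p * s else q * r) *
        parity_weight p q r s u *
        (if odd (length u) then parity_weight p q r s v else parity_weight r s p q v)"
      unfolding length_0_conv
      by (rule parity_weight_append_Cons_less
          [OF Min_less_permutation_around[OF S(1) w(1)] \<open>v \<noteq> []\<close>])
  qed
  show "factors_around (parity_weight p q r s) (parity_weight r s p q)
      (\<lambda>k. if k = 0 then p else if odd k then q * r else p * s) S (Max S) (Min S)"
    unfolding factors_around_def
  proof (intro allI impI)
    fix u v assume w: "u @ Max S # v \<in> permutations_of_set S" "Min S \<in> set v"
    then have "v \<noteq> []"
      by auto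
    show "parity_weight p q r s (u @ Max S # v) =
        (if length u = 0 then p else if odd (length u) then q * r else p * s) *
        parity_weight p q r s u *
        (if odd (length u) then parity_weight p q r s v else parity_weight r s p q v)"
      unfolding length_0_conv
      by (rule parity_weight_append_Cons_greater
          [OF permutation_around_less_Max[OF S(1) w(1)] \<open>v \<noteq> []\<close>])
  qed
qed (simp_all add: add.commute)

lemma sum_parity_weight:
  assumes "finite S"
  shows "(\<Sum>w\<in>permutations_of_set S. parity_weight p q r s w) =
    andre_poly (p + q) (r + s) (p * s + q * r) (card S)"
proof (rule sum_permutations_eq_andre_poly[OF andre_recursive_parity_weight _ assms])
  show "andre_recursive (parity_weight r s p q) (parity_weight p q r s) (r + s) (p * s + q * r)"
    using andre_recursive_parity_weight[of r s p q] by (simp add: mult.commute add.commute)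
qed

lemma A_hat_eq_andre_poly: "A_hat n x y = andre_poly (1 + x) (1 + y) (1 + x * y) n"
  using sum_parity_weight[of "{1..n}" x 1 1 y]
  by (simp add: A_hat_eq_sum_parity_weight add.commute)

section \<open>Andre permutations\<close>

text \<open>Both \<open>u\<close> and \<open>v\<close> are nonempty exactly if the letter \<open>a\<close> of \<open>p @ a # s\<close> is at a valley.\<close>

definition max_increases_around :: "nat list \<Rightarrow> nat \<Rightarrow> nat list \<Rightarrow> bool" where
  "max_increases_around p a s \<longleftrightarrow>
     (let u = takeWhile (\<lambda>b. a < b) (rev p); v = takeWhile (\<lambda>b. a < b) s
      in u \<noteq> [] \<and> v \<noteq> [] \<longrightarrow> Max (set u) < Max (set v))"

definition valleys_andre :: "nat list \<Rightarrow> bool" where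
  "valleys_andre w \<longleftrightarrow> (\<forall>p a s. w = p @ a # s \<longrightarrow> max_increases_around p a s)"

lemma max_increases_around_all_greater:
  assumes "\<forall>b\<in>set u. a < b" "\<forall>b\<in>set v. a < b"
  shows "max_increases_around u a v \<longleftrightarrow> (u \<noteq> [] \<and> v \<noteq> [] \<longrightarrow> Max (set u) < Max (set v))"
proof -
  have "takeWhile (\<lambda>b. a < b) (rev u) = rev u" "takeWhile (\<lambda>b. a < b) v = v"
    using assms by (simp_all add: takeWhile_eq_all_conv)
  then show ?thesis
    by (simp only: max_increases_around_def Let_def set_rev rev_is_Nil_conv)
qed

lemma max_increases_around_cut:
  assumes "m < a"
  shows "max_increases_around p a (s @ m # v) = max_increases_around p a s"
    and "max_increases_around (u @ m # p) a s = max_increases_around p a s"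
  using assms by (simp_all add: max_increases_around_def takeWhile_tail Let_def)

lemma append_Cons_eq_append_Cons_cases:
  assumes "u @ m # v = p @ a # s"
  obtains "p = u" "a = m" "s = v"
    | t where "u = p @ a # t" "s = t @ m # v"
    | t where "v = t @ a # s" "p = u @ m # t"
  using assms by (auto simp: append_eq_append_conv2 Cons_eq_append_conv append_eq_Cons_conv)

lemma valleys_andre_append_Cons:
  assumes u: "\<forall>a\<in>set u. m < a" and v: "\<forall>a\<in>set v. m < a"
  shows "valleys_andre (u @ m # v) \<longleftrightarrow>
    valleys_andre u \<and> valleys_andre v \<and> (u \<noteq> [] \<and> v \<noteq> [] \<longrightarrow> Max (set u) < Max (set v))"
proof -
  have "valleys_andre (u @ m # v) \<longleftrightarrow> max_increases_around u m v \<and>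
      (\<forall>p a t. u = p @ a # t \<longrightarrow> max_increases_around p a (t @ m # v)) \<and>
      (\<forall>t a s. v = t @ a # s \<longrightarrow> max_increases_around (u @ m # t) a s)"
    unfolding valleys_andre_def
    by (auto elim!: append_Cons_eq_append_Cons_cases)
  also have "(\<forall>p a t. u = p @ a # t \<longrightarrow> max_increases_around p a (t @ m # v)) \<longleftrightarrow> valleys_andre u"
    using u max_increases_around_cut(1) unfolding valleys_andre_def by auto
  also have "(\<forall>t a s. v = t @ a # s \<longrightarrow> max_increases_around (u @ m # t) a s) \<longleftrightarrow> valleys_andre v"
    using v max_increases_around_cut(2) unfolding valleys_andre_def by auto
  finally show ?thesis
    using max_increases_around_all_greater[OF assms] by blast
qed

lemma longest_prefix_eq_takeWhile:
  assumes "xs @ ys = zs" "\<forall>b\<in>set xs. R b"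
    and "\<forall>v. prefix v zs \<and> (\<forall>b\<in>set v. R b) \<longrightarrow> length v \<le> length xs"
  shows "xs = takeWhile R zs"
proof -
  have "takeWhile R zs = xs @ takeWhile R ys"
    using assms(1,2) by (metis takeWhile_append2)
  moreover have "length (takeWhile R zs) \<le> length xs"
    using assms(3) by (meson set_takeWhileD takeWhile_is_prefix)
  ultimately show ?thesis
    by simp
qed

lemma letter_factorization_eq_takeWhile:
  assumes "letter_factorization w i (w1, w2, a, w4, w5)"
  shows "w2 = rev (takeWhile (\<lambda>b. letter w i < b) (rev (take (i - 1) w)))"
    and "w4 = takeWhile (\<lambda>b. letter w i < b) (drop i w)"
proof -
  have left: "w1 @ w2 = take (i - 1) w" "\<forall>b\<in>set w2. letter w i < b"
    "\<forall>v. suffix v (take (i - 1) w) \<and> (\<forall>b\<in>set v. letter w i < b) \<longrightarrow> length v \<le> length w2"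
    and right: "w4 @ w5 = drop i w" "\<forall>b\<in>set w4. letter w i < b"
    "\<forall>v. prefix v (drop i w) \<and> (\<forall>b\<in>set v. letter w i < b) \<longrightarrow> length v \<le> length w4"
    using assms unfolding letter_factorization_def by auto
  show "w4 = takeWhile (\<lambda>b. letter w i < b) (drop i w)"
    using right by (rule longest_prefix_eq_takeWhile)
  have "rev w2 = takeWhile (\<lambda>b. letter w i < b) (rev (take (i - 1) w))"
  proof (rule longest_prefix_eq_takeWhile)
    show "rev w2 @ rev w1 = rev (take (i - 1) w)"
      using left(1) by (metis rev_append)
    show "\<forall>v. prefix v (rev (take (i - 1) w)) \<and> (\<forall>b\<in>set v. letter w i < b) \<longrightarrow>
        length v \<le> length (rev w2)"
      using left(3) by (metis length_rev rev_rev_ident set_rev suffix_to_prefix)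
  qed (use left(2) in auto)
  then show "w2 = rev (takeWhile (\<lambda>b. letter w i < b) (rev (take (i - 1) w)))"
    by (metis rev_rev_ident)
qed

lemma valley_append_Cons:
  "valley (p @ a # s) (Suc (length p)) \<longleftrightarrow>
     takeWhile (\<lambda>b. a < b) (rev p) \<noteq> [] \<and> takeWhile (\<lambda>b. a < b) s \<noteq> []"
proof (cases "p = [] \<or> s = []")
  case False
  then obtain p' b c s' where "p = p' @ [b]" "s = c # s'"
    by (metis neq_Nil_conv rev_exhaust)
  then show ?thesis
    by (simp add: valley_def letter_def nth_append)
qed (auto simp: valley_def)

lemma all_valleys_iff_valleys_andre:
  "(\<forall>i. valley w i \<longrightarrow>
      (\<forall>w1 w2 a w4 w5. letter_factorization w i (w1, w2, a, w4, w5) \<longrightarrow>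
         Max (set w2) < Max (set w4))) \<longleftrightarrow> valleys_andre w" (is "(\<forall>i. valley w i \<longrightarrow> ?max i) \<longleftrightarrow> _")
proof -
  have at_letter: "(valley w (Suc (length p)) \<longrightarrow> ?max (Suc (length p))) \<longleftrightarrow> max_increases_around p a s"
    if w: "w = p @ a # s" for p a s
  proof -
    have parts: "letter w (Suc (length p)) = a" "take (Suc (length p) - 1) w = p"
      "drop (Suc (length p)) w = s"
      using w by (simp_all add: letter_def)
    have "?max (Suc (length p)) \<longleftrightarrow>
        Max (set (takeWhile (\<lambda>b. a < b) (rev p))) < Max (set (takeWhile (\<lambda>b. a < b) s))"
      using letter_factorization_exists[of w "Suc (length p)"]
        letter_factorization_eq_takeWhile[of w "Suc (length p)"]
      unfolding parts by (metis set_rev)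
    then show ?thesis
      using valley_append_Cons[of p a s] w by (simp add: max_increases_around_def Let_def)
  qed
  show ?thesis
  proof
    assume "\<forall>i. valley w i \<longrightarrow> ?max i"
    then show "valleys_andre w"
      using at_letter unfolding valleys_andre_def by blast
  next
    assume andre: "valleys_andre w"
    show "\<forall>i. valley w i \<longrightarrow> ?max i"
    proof (rule allI, rule impI)
      fix i assume i: "valley w i"
      then have "w = take (i - 1) w @ w ! (i - 1) # drop i w" "Suc (length (take (i - 1) w)) = i"
        using id_take_nth_drop[of "i - 1" w] by (auto simp: valley_def)
      then show "?max i"
        using at_letter andre i unfolding valleys_andre_def by metis
    qed
  qed
qed

definition andre_word :: "nat list \<Rightarrow> bool" where
  "andre_word w \<longleftrightarrow> no_double_or_final_descent w \<and> valleys_andre w"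

lemma andre_permutations_eq: "andre_permutations n = {w \<in> permutations_of_set {1..n}. andre_word w}"
proof -
  have "no_double_or_final_descent w \<longleftrightarrow>
      no_double_descent w \<and> (2 \<le> n \<longrightarrow> letter w (n - 1) < letter w n)"
    if "w \<in> permutations_of_set {1..n}" for w
  proof -
    have w: "length w = n" "distinct w"
      using that by (simp_all add: length_finite_permutations_of_set permutations_of_setD)
    have "(\<forall>i\<in>descents w. Suc i \<noteq> length w) \<longleftrightarrow> n - 1 \<notin> descents w"
      using descents_bounds[of w] w(1) by (cases n) auto
    also have "\<dots> \<longleftrightarrow> (2 \<le> n \<longrightarrow> \<not> letter w n < letter w (n - 1))"
      using w(1) by (auto simp: descents_def)
    also have "\<dots> \<longleftrightarrow> (2 \<le> n \<longrightarrow> letter w (n - 1) < letter w n)"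
      using w by (auto simp: letter_def nth_eq_iff_index_eq not_less order_le_less)
    finally show ?thesis
      by (auto simp: no_double_or_final_descent_def no_double_descent_def)
  qed
  then show ?thesis
    unfolding andre_permutations_def andre_word_def all_valleys_iff_valleys_andre
      all_not_double_descent_iff by auto
qed

lemma andre_word_append_Cons:
  assumes "\<forall>a\<in>set u. m < a" "\<forall>a\<in>set v. m < a"
  shows "andre_word (u @ m # v) \<longleftrightarrow> andre_word u \<and> andre_word v \<and>
    (u \<noteq> [] \<longrightarrow> v \<noteq> [] \<and> Max (set u) < Max (set v))"
  unfolding andre_word_def no_double_or_final_descent_append_Cons[OF assms]
    valleys_andre_append_Cons[OF assms] by blast

fun alternating_power :: "'a::comm_semiring_1 \<Rightarrow> 'a \<Rightarrow> nat \<Rightarrow> 'a" where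
  "alternating_power a b 0 = 1"
| "alternating_power a b (Suc n) = a * alternating_power b a n"

lemma alternating_power_add:
  "alternating_power a b (k + n) = alternating_power a b k *
     (if odd k then alternating_power b a n else alternating_power a b n)"
  by (induction k arbitrary: a b) (simp_all add: mult.assoc)

lemma alternating_power_complete:
  "(if odd n then b else 1) * alternating_power a b n = (a * b) ^ (Suc n div 2)"
  by (induction n arbitrary: a b rule: induct_nat_012) (simp_all add: mult_ac)

text \<open>
  A nonempty Andre word satisfies \<open>2 * des w < length w\<close>, so the exponent does not truncate. The
  alternation of \<open>a\<close> and \<open>b\<close> makes the weight multiplicative; powers of \<open>a * b\<close> alone would
  need correction factors depending on the parity of the length.
\<close>

definition andre_weight :: "'a::comm_semiring_1 \<Rightarrow> 'a \<Rightarrow> 'a \<Rightarrow> nat list \<Rightarrow> 'a" where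
  "andre_weight a b q w =
     (if andre_word w then alternating_power a b (length w - 1 - 2 * des w) * q ^ des w else 0)"

lemma andre_word_short [simp]: "andre_word []" "andre_word [x]"
  by (auto simp: andre_word_def valleys_andre_def max_increases_around_def Cons_eq_append_conv)

lemma andre_weight_short [simp]: "andre_weight a b q [] = 1" "andre_weight a b q [x] = 1"
  by (simp_all add: andre_weight_def)

lemma andre_weight_Cons:
  assumes "\<forall>a\<in>set v. m < a" "v \<noteq> []"
  shows "andre_weight a b q (m # v) = a * andre_weight b a q v"
proof (cases "andre_word v")
  case True
  have des: "des (m # v) = des v"
    using des_append_Cons[of "[]" m v] assms(1) by simp
  have "2 * des v < length v"
    using True assms(2) by (auto simp: andre_word_def intro: des_less_half_length)
  then have "length (m # v) - 1 - 2 * des (m # v) = Suc (length v - 1 - 2 * des v)"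
    unfolding des by simp
  then show ?thesis
    using andre_word_append_Cons[of "[]" m v] assms(1) True
    by (simp add: andre_weight_def des mult_ac)
next
  case False
  then show ?thesis
    using andre_word_append_Cons[of "[]" m v] assms(1) by (simp add: andre_weight_def)
qed

lemma andre_weight_append_Cons:
  assumes m: "\<forall>a\<in>set u. m < a" "\<forall>a\<in>set v. m < a"
    and nonempty: "u \<noteq> []" "v \<noteq> []" and less: "Max (set u) < Max (set v)"
  shows "andre_weight a b q (u @ m # v) = q * andre_weight a b q u *
    (if odd (length u) then andre_weight a b q v else andre_weight b a q v)"
proof (cases "andre_word u \<and> andre_word v")
  case uv: True
  define k n where "k = length u - 1 - 2 * des u" and "n = length v - 1 - 2 * des v"
  have weights: "andre_weight a b q u = alternating_power a b k * q ^ des u"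
    "andre_weight a b q v = alternating_power a b n * q ^ des v"
    "andre_weight b a q v = alternating_power b a n * q ^ des v"
    using uv by (simp_all add: andre_weight_def k_def n_def)
  have bounds: "2 * des u < length u" "2 * des v < length v"
    using uv nonempty by (auto simp: andre_word_def intro: des_less_half_length)
  have des: "des (u @ m # v) = Suc (des u + des v)"
    using nonempty(1) des_append_Cons[OF m] by simp
  then have "length (u @ m # v) - 1 - 2 * des (u @ m # v) = k + n"
    using bounds by (simp add: k_def n_def)
  then have "andre_weight a b q (u @ m # v) =
      alternating_power a b (k + n) * q ^ Suc (des u + des v)"
    using andre_word_append_Cons[OF m] nonempty less uv by (simp add: andre_weight_def des)
  moreover have "odd k \<longleftrightarrow> even (length u)"
    using bounds(1) by (auto simp: k_def)
  ultimately show ?thesis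
    by (simp add: weights alternating_power_add power_add mult_ac)
next
  case False
  then show ?thesis
    using andre_word_append_Cons[OF m] by (auto simp: andre_weight_def)
qed

lemma not_andre_word_Max_before_Min:
  assumes "finite S" "u @ Max S # v \<in> permutations_of_set S" "Min S \<in> set v"
  shows "\<not> andre_word (u @ Max S # v)"
proof
  assume andre: "andre_word (u @ Max S # v)"
  obtain v1 v2 where "v = v1 @ Min S # v2"
    using assms(3) by (auto dest: split_list)
  then have w: "u @ Max S # v = (u @ Max S # v1) @ Min S # v2"
    by simp
  have perm: "(u @ Max S # v1) @ Min S # v2 \<in> permutations_of_set S"
    using assms(2) unfolding w .
  have "v2 \<noteq> []" "Max (set (u @ Max S # v1)) < Max (set v2)"
    using andre unfolding w andre_word_append_Cons[OF Min_less_permutation_around[OF assms(1) perm]]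
    by auto
  moreover have "Max S \<le> Max (set (u @ Max S # v1))"
    by (rule Max_ge) auto
  moreover have "Max (set v2) \<le> Max S"
    using set_permutation_around(1)[OF perm] \<open>v2 \<noteq> []\<close> assms(1) by (intro Max_mono) auto
  ultimately show False
    by linarith
qed

lemma andre_recursive_andre_weight:
  "andre_recursive (andre_weight a b q) (andre_weight b a q) a q"
proof (rule andre_recursiveI[where m = Min and z = Max
      and c = "\<lambda>k. if k = 0 then a else q" and c' = "\<lambda>_. 0"])
  fix S :: "nat set" assume S: "finite S" "2 \<le> card S"
  show "Min S \<in> S" "Max S \<in> S - {Min S}"
    using S by (rule Min_Max_mem_of_card_ge_2)+
  show "factors_around (andre_weight a b q) (andre_weight b a q)
      (\<lambda>k. if k = 0 then a else q) S (Min S) (Max S)"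
    unfolding factors_around_def length_0_conv
  proof (intro allI impI)
    fix u v assume w: "u @ Min S # v \<in> permutations_of_set S" "Max S \<in> set v"
    note m = Min_less_permutation_around[OF S(1) w(1)]
    have v: "v \<noteq> []"
      using w(2) by auto
    show "andre_weight a b q (u @ Min S # v) = (if u = [] then a else q) * andre_weight a b q u *
        (if odd (length u) then andre_weight a b q v else andre_weight b a q v)"
    proof (cases "u = []")
      case True
      then show ?thesis
        using m v by (simp add: andre_weight_Cons)
    next
      case False
      then show ?thesis
        using m v Max_less_Max_permutation_around[OF S(1) w] by (simp add: andre_weight_append_Cons)
    qed
  qed
  show "factors_around (andre_weight a b q) (andre_weight b a q) (\<lambda>_. 0) S (Max S) (Min S)"
    using S(1) not_andre_word_Max_before_Min by (simp add: factors_around_def andre_weight_def)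
qed simp_all

lemma sum_andre_weight:
  assumes "finite S"
  shows "(\<Sum>w\<in>permutations_of_set S. andre_weight a b q w) = andre_poly a b q (card S)"
  using andre_recursive_andre_weight andre_recursive_andre_weight assms
  by (rule sum_permutations_eq_andre_poly)

section \<open>Simsun permutations\<close>

definition simsun_word :: "nat list \<Rightarrow> bool" where
  "simsun_word w \<longleftrightarrow> (\<forall>k. no_double_descent (filter (\<lambda>a. a \<le> k) w))"

definition strong_simsun_word :: "nat list \<Rightarrow> bool" where
  "strong_simsun_word w \<longleftrightarrow> (\<forall>k. no_double_or_final_descent (filter (\<lambda>a. a \<le> k) w))"

definition simsun_weight :: "'a::comm_semiring_1 \<Rightarrow> nat list \<Rightarrow> 'a" where
  "simsun_weight t w = (if simsun_word w then t ^ des w else 0)"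

definition strong_simsun_weight :: "'a::comm_semiring_1 \<Rightarrow> nat list \<Rightarrow> 'a" where
  "strong_simsun_weight t w = (if strong_simsun_word w then t ^ des w else 0)"

lemma filter_le_append_Cons:
  fixes m :: nat
  assumes "\<forall>a\<in>set u. m < a" "\<forall>a\<in>set v. m < a"
  shows "filter (\<lambda>a. a \<le> k) (u @ m # v) =
    (if m \<le> k then filter (\<lambda>a. a \<le> k) u @ m # filter (\<lambda>a. a \<le> k) v else [])"
    and "\<not> m \<le> k \<Longrightarrow> filter (\<lambda>a. a \<le> k) u = []" "\<not> m \<le> k \<Longrightarrow> filter (\<lambda>a. a \<le> k) v = []"
  using assms by (auto simp: filter_empty_conv)

lemma simsun_word_append_Cons:
  assumes "\<forall>a\<in>set u. m < a" "\<forall>a\<in>set v. m < a"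
  shows "simsun_word (u @ m # v) \<longleftrightarrow> strong_simsun_word u \<and> simsun_word v"
proof -
  have "no_double_descent (filter (\<lambda>a. a \<le> k) (u @ m # v)) \<longleftrightarrow>
      no_double_or_final_descent (filter (\<lambda>a. a \<le> k) u) \<and>
      no_double_descent (filter (\<lambda>a. a \<le> k) v)" for k
    unfolding filter_le_append_Cons(1)[OF assms]
    using assms filter_le_append_Cons(2,3)[OF assms]
    by (simp add: no_double_descent_append_Cons)
  then show ?thesis
    by (auto simp only: simsun_word_def strong_simsun_word_def)
qed

lemma strong_simsun_word_append_Cons:
  assumes "\<forall>a\<in>set u. m < a" "\<forall>a\<in>set v. m < a"
    and z: "z \<in> set v" "\<forall>a\<in>set u. z \<le> a"
  shows "strong_simsun_word (u @ m # v) \<longleftrightarrow> strong_simsun_word u \<and> strong_simsun_word v"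
proof -
  have "filter (\<lambda>a. a \<le> k) v = [] \<longrightarrow> filter (\<lambda>a. a \<le> k) u = []" for k
    using z by (fastforce simp: filter_empty_conv)
  then have "no_double_or_final_descent (filter (\<lambda>a. a \<le> k) (u @ m # v)) \<longleftrightarrow>
      no_double_or_final_descent (filter (\<lambda>a. a \<le> k) u) \<and>
      no_double_or_final_descent (filter (\<lambda>a. a \<le> k) v)" for k
    unfolding filter_le_append_Cons(1)[OF assms(1,2)]
    using assms(1,2) filter_le_append_Cons(2,3)[OF assms(1,2)]
    by (simp add: no_double_or_final_descent_append_Cons)
  then show ?thesis
    by (auto simp only: strong_simsun_word_def)
qed

lemma not_strong_simsun_word_of_smallest_descending:
  assumes "m < z" "\<forall>a\<in>set u \<union> set v \<union> set v'. z < a"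
  shows "\<not> strong_simsun_word (u @ z # v @ m # v')"
proof -
  have "filter (\<lambda>a. a \<le> z) (u @ z # v @ m # v') = [z, m]"
    using assms by (auto simp: filter_empty_conv not_le)
  moreover have "\<not> no_double_or_final_descent [z, m]"
    using assms(1) by (auto simp: no_double_or_final_descent_def descents_def letter_def)
  ultimately show ?thesis
    unfolding strong_simsun_word_def by metis
qed

lemma simsun_weight_append_Cons:
  assumes "\<forall>a\<in>set u. m < a" "\<forall>a\<in>set v. m < a"
  shows "simsun_weight t (u @ m # v) =
    (if u = [] then 1 else t) * strong_simsun_weight t u * simsun_weight t v"
  by (simp add: simsun_weight_def strong_simsun_weight_def simsun_word_append_Cons[OF assms]
      des_append_Cons[OF assms] power_add mult_ac)

lemma strong_simsun_weight_append_Cons: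
  assumes "\<forall>a\<in>set u. m < a" "\<forall>a\<in>set v. m < a" "z \<in> set v" "\<forall>a\<in>set u. z \<le> a"
  shows "strong_simsun_weight t (u @ m # v) =
    (if u = [] then 1 else t) * strong_simsun_weight t u * strong_simsun_weight t v"
  by (simp add: strong_simsun_weight_def strong_simsun_word_append_Cons[OF assms]
      des_append_Cons[OF assms(1,2)] power_add mult_ac)

lemma factors_around_strong_simsun_weight:
  assumes "\<forall>a\<in>S - {m}. m < a \<and> z \<le> a"
  shows "factors_around (strong_simsun_weight t) (strong_simsun_weight t)
    (\<lambda>k. if k = 0 then 1 else t) S m z"
  unfolding factors_around_def length_0_conv if_cancel
proof (intro allI impI)
  fix u v assume w: "u @ m # v \<in> permutations_of_set S" "z \<in> set v"
  have "\<forall>a\<in>set u \<union> set v. m < a \<and> z \<le> a"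
    using assms set_permutation_around(1)[OF w(1)] by simp
  then show "strong_simsun_weight t (u @ m # v) =
      (if u = [] then 1 else t) * strong_simsun_weight t u * strong_simsun_weight t v"
    using w(2) by (intro strong_simsun_weight_append_Cons) auto
qed

lemma strong_simsun_weight_vanishes_around:
  assumes "m < z" "\<forall>a\<in>S - {m}. z \<le> a"
  shows "factors_around (strong_simsun_weight t) (strong_simsun_weight t) (\<lambda>_. 0) S z m"
  unfolding factors_around_def
proof (intro allI impI)
  fix u v assume w: "u @ z # v \<in> permutations_of_set S" "m \<in> set v"
  then obtain v1 v2 where v: "v = v1 @ m # v2"
    by (auto dest: split_list)
  have "\<forall>a\<in>set u \<union> set v1 \<union> set v2. z < a"
  proof
    fix a assume "a \<in> set u \<union> set v1 \<union> set v2"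
    then have "a \<in> S - {m}" "a \<noteq> z"
      using w(1) by (auto simp: v permutations_of_set_def)
    then show "z < a"
      using assms(2) by (simp add: order_less_le)
  qed
  then have "\<not> strong_simsun_word (u @ z # v)"
    using not_strong_simsun_word_of_smallest_descending[OF assms(1)] by (simp add: v)
  then show "strong_simsun_weight t (u @ z # v) = 0 * strong_simsun_weight t u *
      (if odd (length u) then strong_simsun_weight t v else strong_simsun_weight t v)"
    by (simp add: strong_simsun_weight_def)
qed

lemma andre_recursive_strong_simsun_weight:
  "andre_recursive (strong_simsun_weight t) (strong_simsun_weight t) 1 t"
proof (rule andre_recursiveI[where m = Min and z = "\<lambda>S. Min (S - {Min S})"
      and c = "\<lambda>k. if k = 0 then 1 else t" and c' = "\<lambda>_. 0"])
  fix S :: "nat set" assume S: "finite S" "2 \<le> card S"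
  let ?m = "Min S" and ?z = "Min (S - {Min S})"
  show "?m \<in> S"
    using S by (rule Min_Max_mem_of_card_ge_2)
  have "S - {?m} \<noteq> {}"
    using Min_Max_mem_of_card_ge_2(2)[OF S] by blast
  then show z: "?z \<in> S - {?m}"
    using S(1) by (intro Min_in) auto
  have "\<forall>a\<in>S - {?m}. ?m < a \<and> ?z \<le> a"
    using S(1) by (auto simp: order_less_le)
  then show "factors_around (strong_simsun_weight t) (strong_simsun_weight t)
      (\<lambda>k. if k = 0 then 1 else t) S ?m ?z"
    and "factors_around (strong_simsun_weight t) (strong_simsun_weight t) (\<lambda>_. 0) S ?z ?m"
    using z by (blast intro: factors_around_strong_simsun_weight
        strong_simsun_weight_vanishes_around)+
qed (simp_all add: strong_simsun_weight_def strong_simsun_word_def)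

lemma sum_strong_simsun_weight:
  assumes "finite S"
  shows "(\<Sum>w\<in>permutations_of_set S. strong_simsun_weight t w) = andre_poly 1 1 t (card S)"
  using andre_recursive_strong_simsun_weight andre_recursive_strong_simsun_weight assms
  by (rule sum_permutations_eq_andre_poly)

lemma sum_simsun_weight:
  assumes "finite S"
  shows "(\<Sum>w\<in>permutations_of_set S. simsun_weight t w) = andre_poly 1 1 t (Suc (card S))"
  using assms
proof (induction "card S" arbitrary: S rule: less_induct)
  case less
  note fin = less.prems
  show ?case
  proof (cases "card S")
    case 0
    then show ?thesis
      using fin by (simp add: simsun_weight_def simsun_word_def)
  next
    case (Suc n)
    then have "Min S \<in> S"
      using fin by (intro Min_in) auto
    then have card: "card (S - {Min S}) = n"
      using Suc by simp
    have "(\<Sum>w\<in>permutations_preceding S (Min S) {}. simsun_weight t w) =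
       (\<Sum>k\<le>n. of_nat (n choose k) *
          ((if k = 0 then 1 else t) * andre_poly 1 1 t k * andre_poly 1 1 t (Suc n - k)))"
    proof (rule sum_permutations_preceding)
      show "simsun_weight t (u @ Min S # v) =
          (if length u = 0 then 1 else t) * strong_simsun_weight t u * simsun_weight t v"
        if "u @ Min S # v \<in> permutations_of_set S" for u v
        using Min_less_permutation_around[OF fin that] unfolding length_0_conv
        by (rule simsun_weight_append_Cons)
      show "(\<Sum>v\<in>permutations_of_set T. simsun_weight t v) = andre_poly 1 1 t (Suc n - k)"
        if T: "T \<subseteq> S - {Min S}" "card T + k = card (S - {Min S})" for T k
      proof -
        have "card T < card S" "finite T" "Suc (card T) = Suc n - k"
          using T Suc card fin by (auto intro: finite_subset)
        then show ?thesis
          using less.hyps by simp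
      qed
    qed (use fin card \<open>Min S \<in> S\<close> in \<open>auto intro: sum_strong_simsun_weight finite_subset\<close>)
    then show ?thesis
      using \<open>Min S \<in> S\<close> by (simp add: permutations_preceding_empty Suc)
  qed
qed

lemma simsun_permutations_eq:
  "simsun_permutations m = {w \<in> permutations_of_set {1..m}. simsun_word w}"
proof -
  have "simsun_word w"
    if w: "w \<in> permutations_of_set {1..m}"
      and simsun: "\<forall>k\<in>{1..m}. no_double_descent (filter (\<lambda>a. a \<le> k) w)" for w
    unfolding simsun_word_def
  proof
    fix k
    have letters: "set w = {1..m}"
      using w by (rule permutations_of_setD)
    then have min: "filter (\<lambda>a. a \<le> k) w = filter (\<lambda>a. a \<le> min k m) w"
      by (intro filter_cong) auto
    show "no_double_descent (filter (\<lambda>a. a \<le> k) w)"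
    proof (cases "min k m = 0")
      case True
      then have "filter (\<lambda>a. a \<le> k) w = []"
        using letters unfolding min True by (simp add: filter_empty_conv)
      then show ?thesis
        by simp
    next
      case False
      then have "min k m \<in> {1..m}"
        by auto
      then show ?thesis
        unfolding min by (rule bspec[OF simsun])
    qed
  qed
  then show ?thesis
    unfolding simsun_permutations_def all_not_double_descent_iff by (auto simp: simsun_word_def)
qed

lemma rs_eq_andre_poly: "rs m x = andre_poly 1 1 x (Suc m)"
proof -
  have "rs m x = (\<Sum>w\<in>permutations_of_set {1..m}. simsun_weight x w)"
    by (simp add: rs_def simsun_permutations_eq simsun_weight_def sum.inter_filter)
  then show ?thesis
    by (simp add: sum_simsun_weight)
qed

section \<open>Expansion in the numbers \<open>d_bar\<close>\<close>

lemma andre_permutation_length_des: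
  assumes "w \<in> andre_permutations n" "n \<ge> 1"
  shows "length w = n" "2 * des w < n"
proof -
  have "w \<in> permutations_of_set {1..n}" "andre_word w"
    using assms(1) by (auto simp: andre_permutations_eq)
  then show length: "length w = n"
    using length_finite_permutations_of_set[of w "{1..n}"] by simp
  moreover have "w \<noteq> []"
    using length assms(2) by auto
  ultimately show "2 * des w < n"
    using \<open>andre_word w\<close> des_less_half_length[of w] by (simp add: andre_word_def)
qed

lemma sum_andre_permutations:
  assumes "n \<ge> 1"
  shows "(\<Sum>w\<in>andre_permutations n. (a * b) ^ (n div 2 - des w) * q ^ des w) =
    (if even n then b else 1) * andre_poly a b q n"
proof -
  have "(a * b) ^ (n div 2 - des w) * q ^ des w = (if even n then b else 1) * andre_weight a b q w"
    if w: "w \<in> andre_permutations n" for w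
  proof -
    have "Suc (n - 1 - 2 * des w) div 2 = n div 2 - des w" "odd (n - 1 - 2 * des w) \<longleftrightarrow> even n"
      using andre_permutation_length_des(2)[OF w assms] by auto
    then have "(a * b) ^ (n div 2 - des w) =
        (if even n then b else 1) * alternating_power a b (n - 1 - 2 * des w)"
      using alternating_power_complete[of "n - 1 - 2 * des w" b a] by simp
    then show ?thesis
      using w andre_permutation_length_des(1)[OF w assms]
      by (simp add: andre_weight_def andre_permutations_eq mult.assoc)
  qed
  then have "(\<Sum>w\<in>andre_permutations n. (a * b) ^ (n div 2 - des w) * q ^ des w) =
      (if even n then b else 1) * (\<Sum>w\<in>andre_permutations n. andre_weight a b q w)"
    by (simp add: sum_distrib_left)
  also have "(\<Sum>w\<in>andre_permutations n. andre_weight a b q w) =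
      (\<Sum>w\<in>permutations_of_set {1..n}. andre_weight a b q w)"
    unfolding andre_permutations_eq
    by (intro sum.mono_neutral_left) (auto simp: andre_weight_def)
  finally show ?thesis
    by (simp add: sum_andre_weight)
qed

lemma d_bar_eq_sum_andre_permutations:
  assumes "n \<ge> 1"
  shows "d_bar n i = (\<Sum>w\<in>andre_permutations n. des w choose i)"
proof -
  have "d_bar n i = (\<Sum>j\<le>n div 2. (j choose i) * d n j)"
    unfolding d_bar_def by (rule sum.mono_neutral_left) (auto simp: not_le)
  also have "\<dots> = (\<Sum>j\<le>n div 2. \<Sum>w\<in>{w \<in> andre_permutations n. des w = j}. des w choose i)"
    by (simp add: d_def mult.commute)
  also have "\<dots> = (\<Sum>w\<in>andre_permutations n. des w choose i)"
  proof (rule sum.group)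
    show "des ` andre_permutations n \<subseteq> {..n div 2}"
      using andre_permutation_length_des(2)[OF _ assms] by fastforce
  qed (simp_all add: andre_permutations_eq)
  finally show ?thesis .
qed

lemma binomial_homogeneous:
  fixes x y :: "'a::comm_semiring_1"
  assumes "j \<le> m"
  shows "(\<Sum>i = 0..m. of_nat (j choose i) * (x ^ i * y ^ (m - i))) = y ^ (m - j) * (x + y) ^ j"
proof -
  have "(\<Sum>i = 0..m. of_nat (j choose i) * (x ^ i * y ^ (m - i))) =
      (\<Sum>i\<le>j. of_nat (j choose i) * (x ^ i * y ^ (m - i)))"
    using assms by (intro sum.mono_neutral_right ballI subsetI) (simp_all add: not_le binomial_eq_0)
  also have "\<dots> = (\<Sum>i\<le>j. y ^ (m - j) * (of_nat (j choose i) * x ^ i * y ^ (j - i)))"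
  proof (intro sum.cong refl)
    fix i assume "i \<in> {..j}"
    then have "m - i = (m - j) + (j - i)"
      using assms by simp
    then show "of_nat (j choose i) * (x ^ i * y ^ (m - i)) =
        y ^ (m - j) * (of_nat (j choose i) * x ^ i * y ^ (j - i))"
      by (simp add: power_add mult_ac)
  qed
  also have "\<dots> = y ^ (m - j) * (x + y) ^ j"
    by (simp add: binomial_ring sum_distrib_left)
  finally show ?thesis .
qed

lemma sum_d_bar_eq_andre_poly:
  assumes "n \<ge> 1"
  shows "(\<Sum>i = 0..n div 2. of_nat (d_bar n i) * (s ^ i * (a * b) ^ (n div 2 - i))) =
    (if even n then b else 1) * andre_poly a b (s + a * b) n"
proof -
  have "(\<Sum>i = 0..n div 2. of_nat (d_bar n i) * (s ^ i * (a * b) ^ (n div 2 - i))) =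
      (\<Sum>w\<in>andre_permutations n. \<Sum>i = 0..n div 2.
         of_nat (des w choose i) * (s ^ i * (a * b) ^ (n div 2 - i)))"
    unfolding d_bar_eq_sum_andre_permutations[OF assms]
    by (simp add: sum_distrib_right sum.swap[of _ "andre_permutations n"])
  also have "\<dots> = (\<Sum>w\<in>andre_permutations n. (a * b) ^ (n div 2 - des w) * (s + a * b) ^ des w)"
  proof (intro sum.cong refl binomial_homogeneous)
    show "des w \<le> n div 2" if "w \<in> andre_permutations n" for w
      using andre_permutation_length_des(2)[OF that assms] by simp
  qed
  also have "\<dots> = (if even n then b else 1) * andre_poly a b (s + a * b) n"
    using assms by (rule sum_andre_permutations)
  finally show ?thesis .
qed

theorem theorem2p9:
  fixes n :: nat and x y :: "'a::comm_ring_1"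
  assumes "n \<ge> 1"
  shows "A_bar n x y =
           (\<Sum>i = 0..n div 2. (- 1) ^ i * of_nat (d_bar n i) * (x + y) ^ i
              * (1 + x + y + x * y) ^ (n div 2 - i))
       \<and> rs (n - 1) (1 + x) = (\<Sum>i = 0..n div 2. of_nat (d_bar n i) * x ^ i)"
proof
  have factor: "(1 + x) * (1 + y) = 1 + x + y + x * y"
    by (simp add: algebra_simps)
  have "A_bar n x y = (if even n then 1 + y else 1) * andre_poly (1 + x) (1 + y) (1 + x * y) n"
    by (simp add: A_bar_def A_hat_eq_andre_poly)
  also have "1 + x * y = - (x + y) + (1 + x) * (1 + y)"
    by (simp add: factor)
  also have "(if even n then 1 + y else 1) * andre_poly (1 + x) (1 + y) \<dots> n =
      (\<Sum>i = 0..n div 2. of_nat (d_bar n i) *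
         ((- (x + y)) ^ i * ((1 + x) * (1 + y)) ^ (n div 2 - i)))"
    by (rule sum_d_bar_eq_andre_poly[OF assms, symmetric])
  also have "\<dots> = (\<Sum>i = 0..n div 2. (- 1) ^ i * of_nat (d_bar n i) * (x + y) ^ i
      * (1 + x + y + x * y) ^ (n div 2 - i))"
    unfolding factor power_minus[of "x + y"] by (simp only: mult_ac)
  finally show "A_bar n x y = (\<Sum>i = 0..n div 2. (- 1) ^ i * of_nat (d_bar n i) * (x + y) ^ i
      * (1 + x + y + x * y) ^ (n div 2 - i))" .
  show "rs (n - 1) (1 + x) = (\<Sum>i = 0..n div 2. of_nat (d_bar n i) * x ^ i)"
    using sum_d_bar_eq_andre_poly[OF assms, of x 1 1] assms
    by (simp add: rs_eq_andre_poly add.commute)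
qed

end
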